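(* Let $\gamma,\eta,\omega,\lambda\in\mathbb{R}$, $a,b\in\mathbb{C}$, $k\in\mathbb{Z}$, $m\in\mathbb{N}$ and $n\in\mathbb{N}_0$. Then $${}_{\mathfrak{B}}\mathfrak{D}_{n,a+b}^{[k,m-1]}(\gamma,\eta+\omega;\lambda)=\sum_{j=0}^{n}\binom{n}{j}\;{}_{\mathfrak{B}}\mathfrak{D}_{n-j,a}^{[k,m-1]}(\gamma,\eta;\lambda)\,\mathfrak{B}_{j,b}^{[m-1]}(\omega;\lambda),$$ where ${}_{\mathfrak{B}}\mathfrak{D}_{n,a}^{[k,m-1]}$ are the generalized Apostol-Bernoulli poly-Daehee polynomials and $\mathfrak{B}_{j,b}^{[m-1]}$ the generalized Apostol-Bernoulli polynomials.
   Context: $\mathbb{N}=\{1,2,\dots\}$, $\mathbb{N}_0=\mathbb{N}\cup\{0\}$. The polylogarithm is $\mathrm{Li}_k(z)=\sum_{r=1}^{\infty} z^r/r^k$. Generalized Apostol-Bernoulli poly-Daehee polynomials (GABPDP), defined by the generating function $$(1+x)^{\gamma}\,\frac{\log(1+x)}{\mathrm{Li}_k(1-e^{-x})}\,e^{\eta x}\left(\frac{x^m}{\lambda e^x-\sum_{l=0}^{m-1}\frac{x^l}{l!}}\right)^{a}=\sum_{n=0}^\infty {}_{\mathfrak{B}}\mathfrak{D}_{n,a}^{[k,m-1]}(\gamma,\eta;\lambda)\frac{x^n}{n!}.$$ Generalized Apostol-Bernoulli polynomials of order $a\in\mathbb{C}$: $$e^{\eta x}\left(\frac{x^m}{\lambda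 e^x-\sum_{l=0}^{m-1}\frac{x^l}{l!}}\right)^{a}=\sum_{n=0}^\infty\mathfrak{B}_{n,a}^{[m-1]}(\eta;\lambda)\frac{x^n}{n!}.$$
   Formalization: For λ ≠ 1 it is assumed that ma and mb are nonnegative integers; otherwise the defining power series of the polynomials of order a or b do not exist (e.g. λ=2, m=1, a=1/2). For λ = 1 all complex a, b are allowed. *)

theory Defs
  imports "HOL-Analysis.Analysis"
begin

text \<open>
  Generating functions are formal power series over the complex numbers.
\<close>

text \<open>
  The power of a nonzero series \<open>f = X^d u\<close>, where \<open>u\<close> has the nonzero constant term \<open>c\<close>, is
  \<open>f^a = X^(d a) c^a (1 + (u / c - 1))^a\<close>: the numerical power \<open>c^a\<close> takes its principal value
  and the last factor is the binomial series. This is a power series exactly if \<open>d a\<close> is a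
  natural number; otherwise the value below is meaningless.
\<close>

definition fps_cpow :: "complex fps \<Rightarrow> complex \<Rightarrow> complex fps" where
  "fps_cpow f a =
     (let u = unit_factor f; c = fps_nth u 0
      in fps_X ^ (THE p. of_nat p = of_nat (subdegree f) * a) * fps_const (c powr a) *
         (fps_binomial a oo (fps_const (inverse c) * u - 1)))"

definition fps_cpow_defined :: "complex fps \<Rightarrow> complex \<Rightarrow> bool" where
  "fps_cpow_defined f a \<longleftrightarrow> f \<noteq> 0 \<and> of_nat (subdegree f) * a \<in> \<nat>"

text \<open>\<open>x^m / (lam e^x - \<Sum>l<m. x^l / l!)\<close>\<close>

definition apostol_base :: "nat \<Rightarrow> real \<Rightarrow> complex fps" where
  "apostol_base m lam =
     fps_X ^ m /
     (fps_const (of_real lam) * fps_exp 1 - (\<Sum>l<m. fps_const (1 / fact l) * fps_X ^ l))"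

text \<open>
  In the following two definitions the parameter \<open>m\<close> corresponds to the superscript \<open>[m-1]\<close>,
  and the last argument is the index \<open>n\<close>.
\<close>

definition gen_apostol_bernoulli :: "nat \<Rightarrow> complex \<Rightarrow> real \<Rightarrow> real \<Rightarrow> nat \<Rightarrow> complex" where
  "gen_apostol_bernoulli m a \<eta> lam n =
     fact n * fps_nth (fps_exp (of_real \<eta>) * fps_cpow (apostol_base m lam) a) n"

definition polylog_fps :: "int \<Rightarrow> complex fps" where
  "polylog_fps k = Abs_fps (\<lambda>r. if r = 0 then 0 else 1 / of_nat r powi k)"

text \<open>
  \<open>fps_binomial \<gamma>\<close> is \<open>(1 + x)^\<gamma>\<close> and \<open>fps_ln 1\<close> is \<open>log (1 + x)\<close>. Both \<open>log (1 + x)\<close> and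
  \<open>Li\<^sub>k (1 - e^(-x))\<close> vanish to order exactly one, so their quotient is a power series.
\<close>

definition gabpdp :: "int \<Rightarrow> nat \<Rightarrow> complex \<Rightarrow> real \<Rightarrow> real \<Rightarrow> real \<Rightarrow> nat \<Rightarrow> complex" where
  "gabpdp k m a \<gamma> \<eta> lam n =
     fact n * fps_nth
       (fps_binomial (of_real \<gamma>) * (fps_ln 1 / (polylog_fps k oo (1 - fps_exp (-1)))) *
        fps_exp (of_real \<eta>) * fps_cpow (apostol_base m lam) a) n"

lemma fps_cpow_of_nat:
  assumes "f \<noteq> 0"
  shows "fps_cpow f (of_nat p) = f ^ p"
proof -
  define u where "u = unit_factor f"
  define c where "c = fps_nth u 0"
  have c: "c \<noteq> 0"
    unfolding c_def u_def by (rule fps_unit_factor_nth_0[OF assms])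
  have the: "(THE q. of_nat q = (of_nat (subdegree f) * of_nat p :: complex)) = subdegree f * p"
    by (rule the_equality) (auto simp flip: of_nat_mult)
  have 0: "fps_nth (fps_const (inverse c) * u - 1) 0 = 0"
    using c by (simp add: c_def)
  have "fps_binomial (of_nat p :: complex) oo (fps_const (inverse c) * u - 1)
      = (fps_const (inverse c) * u) ^ p"
    using 0 by (simp add: fps_binomial_of_nat fps_compose_add_distrib
        flip: fps_compose_power)
  also have "fps_const (c powr of_nat p) * \<dots> = (fps_const c * (fps_const (inverse c) * u)) ^ p"
    using c by (simp add: power_mult_distrib fps_const_power)
  also have "fps_const c * (fps_const (inverse c) * u) = u"
    using c by (simp flip: mult.assoc)
  finally have "fps_cpow f (of_nat p) = fps_X ^ (subdegree f * p) * u ^ p"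
    unfolding fps_cpow_def Let_def the u_def[symmetric] c_def[symmetric]
    by (simp add: mult.assoc)
  also have "\<dots> = (fps_X ^ subdegree f * u) ^ p"
    by (simp add: power_mult power_mult_distrib)
  also have "fps_X ^ subdegree f * u = f"
    unfolding u_def by (rule fps_unit_factor_decompose'[symmetric])
  finally show ?thesis .
qed

lemma apostol_denominator_nth:
  "fps_nth (fps_const (of_real lam) * fps_exp 1
      - (\<Sum>l<m. fps_const (1 / fact l) * fps_X ^ l) :: complex fps) n
   = (if n < m then (of_real lam - 1) / fact n else of_real lam / fact n)"
proof -
  have "(\<Sum>l<m. fps_nth (fps_const (1 / fact l) * fps_X ^ l :: complex fps) n)
      = (\<Sum>l<m. if n = l then 1 / fact n else 0)"
    by (intro sum.cong) auto
  also have "\<dots> = (if n < m then 1 / fact n else 0)"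
    by simp
  finally show ?thesis
    by (simp add: fps_sum_nth diff_divide_distrib)
qed

lemma apostol_base_nonzero_subdegree:
  assumes "m \<ge> 1"
  shows "apostol_base m lam \<noteq> 0"
    and "subdegree (apostol_base m lam) = (if lam = 1 then 0 else m)"
proof -
  define g :: "complex fps" where
    "g = fps_const (of_real lam) * fps_exp 1 - (\<Sum>l<m. fps_const (1 / fact l) * fps_X ^ l)"
  have nth: "fps_nth g n = (if n < m then (of_real lam - 1) / fact n else of_real lam / fact n)" for n
    unfolding g_def by (rule apostol_denominator_nth)
  have sub: "subdegree g = (if lam = 1 then m else 0)"
    using assms by (auto intro!: subdegreeI simp: nth)
  have "fps_nth g (if lam = 1 then m else 0) \<noteq> 0"
    using assms by (auto simp: nth)
  hence g: "g \<noteq> 0"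
    by auto
  have "fps_nth (fps_X ^ m / g) (m - subdegree g) \<noteq> 0"
    using fps_divide_nth_base[of g "fps_X ^ m"] g sub assms
    by (simp add: fps_X_power_subdegree nth)
  thus "apostol_base m lam \<noteq> 0"
    unfolding apostol_base_def g_def[symmetric] by auto
  show "subdegree (apostol_base m lam) = (if lam = 1 then 0 else m)"
    unfolding apostol_base_def g_def[symmetric]
    using fps_divide_subdegree[of "fps_X ^ m" g] g sub by (simp add: fps_X_power_subdegree)
qed

text \<open>
  If \<open>lam = 1\<close>, the base has a nonzero constant term and every complex power of it exists.
  Otherwise it vanishes to order \<open>m\<close> at \<open>0\<close>, and the polynomials of order \<open>a\<close> exist only if
  \<open>m a\<close> is a natural number.
\<close>

lemma apostol_power_defined_iff:
  assumes "m \<ge> 1"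
  shows "fps_cpow_defined (apostol_base m lam) a \<longleftrightarrow> lam = 1 \<or> of_nat m * a \<in> \<nat>"
  using apostol_base_nonzero_subdegree[OF assms, of lam] by (auto simp: fps_cpow_defined_def)

end

theory Submission
  imports Defs
begin

text \<open>In the generating function of order \<open>a + b\<close> at
  \<open>\<eta> + \<omega>\<close>, only the exponential and the power of the base depend on these
  sums, and both turn sums into products. The series is therefore the GABPDP series for
  \<open>(a, \<eta>)\<close> times the Apostol-Bernoulli series for \<open>(b, \<omega>)\<close>,
  and a product of exponential generating functions has binomially convolved coefficients
  (\<open>fact_fps_mult_nth\<close>). The law f^(a+b) = f^a f^b (\<open>fps_cpow_add\<close>) needs
  both powers to exist, which the condition on \<open>lam\<close> ensures.\<close>

text \<open>Each of the three factors of the power is additive in the exponent: the monomial, the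
  principal value (one fixed logarithm of the constant \<open>c\<close>), and the binomial series by
  Vandermonde's identity.\<close>

lemma fps_cpow_add:
  assumes "fps_cpow_defined f a" and "fps_cpow_defined f b"
  shows "fps_cpow f (a + b) = fps_cpow f a * fps_cpow f b"
proof -
  obtain p q where p: "of_nat (subdegree f) * a = of_nat p"
    and q: "of_nat (subdegree f) * b = of_nat q"
    using assms by (auto simp: fps_cpow_defined_def elim!: Nats_cases)
  \<comment> \<open>Injectivity of \<open>of_nat\<close> resolves the description in
    \<open>fps_cpow\<close> to \<open>p\<close>, \<open>q\<close> and \<open>p + q\<close>.\<close>
  have the: "(THE r. of_nat r = (of_nat s :: complex)) = s" for s :: nat
    by (rule the_equality) auto
  have pq: "of_nat (subdegree f) * (a + b) = of_nat (p + q)"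
    using p q by (simp add: distrib_left)
  define u where "u = unit_factor f"
  define c where "c = fps_nth u 0"
  define h where "h = fps_const (inverse c) * u - 1"
  \<comment> \<open>Since \<open>c\<close> is nonzero, \<open>h\<close> has no constant term, which
    makes composition with \<open>h\<close> multiplicative.\<close>
  have "c \<noteq> 0"
    using assms unfolding c_def u_def fps_cpow_defined_def by (intro fps_unit_factor_nth_0) simp
  hence h: "fps_nth h 0 = 0"
    by (simp add: h_def c_def)
  have "fps_cpow f (a + b) = fps_X ^ (p + q) * fps_const (c powr (a + b)) *
      (fps_binomial (a + b) oo h)"
    unfolding fps_cpow_def Let_def pq the u_def[symmetric] c_def[symmetric] h_def[symmetric] ..
  also have "fps_binomial (a + b) oo h = (fps_binomial a oo h) * (fps_binomial b oo h)"
    by (simp add: fps_binomial_add_mult fps_compose_mult_distrib[OF h])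
  also have "fps_X ^ (p + q) * fps_const (c powr (a + b)) * \<dots> =
      (fps_X ^ p * fps_const (c powr a) * (fps_binomial a oo h)) *
      (fps_X ^ q * fps_const (c powr b) * (fps_binomial b oo h))"
    by (simp add: power_add powr_add mult_ac flip: fps_const_mult)
  also have "\<dots> = fps_cpow f a * fps_cpow f b"
    unfolding fps_cpow_def Let_def p q the u_def[symmetric] c_def[symmetric] h_def[symmetric] ..
  finally show ?thesis .
qed

lemma fact_fps_mult_nth:
  fixes F G :: "'a::field_char_0 fps"
  shows "fact n * fps_nth (F * G) n =
    (\<Sum>j=0..n. of_nat (n choose j) * (fact (n - j) * fps_nth F (n - j)) * (fact j * fps_nth G j))"
proof -
  have "fact n * fps_nth (F * G) n = (\<Sum>j=0..n. fact n * (fps_nth G j * fps_nth F (n - j)))"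
    \<comment> \<open>Commuting the factors gives \<open>G\<close> the index \<open>j\<close> and
      \<open>F\<close> the index \<open>n - j\<close>.\<close>
    by (simp add: mult.commute[of F] fps_mult_nth sum_distrib_left)
  also have "\<dots> = (\<Sum>j=0..n. of_nat (n choose j) * (fact (n - j) * fps_nth F (n - j)) *
      (fact j * fps_nth G j))"
    by (intro sum.cong) (simp_all add: binomial_fact)
  finally show ?thesis .
qed

theorem theorem3p2:
  fixes \<gamma> \<eta> \<omega> lam :: real and a b :: complex and k :: int and m n :: nat
  assumes "m \<ge> 1"
    and "lam = 1 \<or> (of_nat m * a \<in> \<nat> \<and> of_nat m * b \<in> \<nat>)"
  shows "gabpdp k m (a + b) \<gamma> (\<eta> + \<omega>) lam n =
    (\<Sum>j=0..n. of_nat (n choose j) * gabpdp k m a \<gamma> \<eta> lam (n - j)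
                 * gen_apostol_bernoulli m b \<omega> lam j)"
proof -
  have "fps_cpow (apostol_base m lam) (a + b) =
      fps_cpow (apostol_base m lam) a * fps_cpow (apostol_base m lam) b"
    using assms by (intro fps_cpow_add) (auto simp: apostol_power_defined_iff)
  then show ?thesis
    \<comment> \<open>Read backwards, the convolution formula folds the sum into one coefficient of
      a product of series.\<close>
    unfolding gabpdp_def gen_apostol_bernoulli_def fact_fps_mult_nth[symmetric]
    by (simp add: fps_exp_add_mult mult_ac)
qed

end
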